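(* Fix any permutation $\pi_\alpha$ of $\mathcal{I}_L$ and, for each $m\in\mathcal{I}_L$, define the compressed codeword $$\delta_m=\Big(\sum_{k\in\mathcal{J}_{\pi_\alpha^{-1}(m)}} v_{m,k}\Big)\bmod \Lambda_{J_m^{\min}},$$ where $J_m^{\min}$ is the minimal element of $\mathcal{J}_{\pi_\alpha^{-1}(m)}$. Then this compression is information lossless: $(v_1,\dots,v_L)$ can be recovered exactly from $(\delta_1,\dots,\delta_L)$, i.e. $(v_1,\dots,v_L)$ is a deterministic function of $(\delta_1,\dots,\delta_L)$ (together with the known dithers $d_1,\dots,d_L$ and the fixed system parameters).
   Context: Notation: for a lattice $\Lambda\subset\mathbb{R}^n$, $Q_\Lambda(x)$ is the nearest point of $\Lambda$ to $x$ (ties broken by a fixed rule), $x\bmod\Lambda=x-Q_\Lambda(x)$, and $\mathcal{V}(\Lambda)=\{x:Q_\Lambda(x)=0\}$ is the fundamental Voronoi region. $\mathcal{I}_j=\{1,\dots,j\}$, $\mathcal{I}_0=\emptyset$, and for $\mathcal{S}\subseteq\mathcal{I}_L$, $\overline{\mathcal{S}}=\mathcal{I}_L\setminus\mathcal{S}$. Logarithms are base 2. Lattice chain (Construction A): $\gamma$ is a prime, $L,n,K$ are positive integers, $G\in\mathbb{F}_\gamma^{n\times K}$ has full column rank over $\mathbb{F}_\gamma$, $B\in\mathbb{R}^{n\times n}$ is invertible, and $g:\mathbb{F}_\gamma\to\{0,\dots,\gamma-1\}$ is the natural bijection applied entrywise. For integers $0\le i_1\le\cdots\le i_{2L}\le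 K$ and $k\in\mathcal{I}_{2L}$, let $G_k$ consist of the first $i_k$ columns of $G$ and $\Lambda_k=B\big(\gamma^{-1}g(\{G_kw:w\in\mathbb{F}_\gamma^{i_k}\})+\mathbb{Z}^n\big)$, so $\Lambda_1\subseteq\cdots\subseteq\Lambda_{2L}$. Write $\mathcal{V}_k=\mathcal{V}(\Lambda_k)$. Sources: $\pi$ is a permutation of $\mathcal{I}_{2L}$ with $\Lambda_{\pi(2l-1)}\subseteq\Lambda_{\pi(2l)}$ for all $l\in\mathcal{I}_L$; $\Lambda_{s,l}=\Lambda_{\pi(2l-1)}$ (shaping lattice), $\Lambda_{c,l}=\Lambda_{\pi(2l)}$ (coding lattice), codebook $\mathcal{C}_l=\Lambda_{c,l}\cap\mathcal{V}(\Lambda_{s,l})$. The codewords $t_1,\dots,t_L$ are independent with $t_l$ uniform on $\mathcal{C}_l$. Scalars $\beta_l>0$; dithers $d_l$ are uniform on $\mathcal{V}(\Lambda_{s,l})/\beta_l$, mutually independent and independent of the $t_l$. For $k\in\mathcal{I}_{2L-1}$, $\mathcal{L}_k=\{l\in\mathcal{I}_L:\Lambda_{s,l}\subseteq\Lambda_k\subseteq\Lambda_{k+1}\subseteq\Lambda_{c,l}\}$. Computed codewords: $A=(a_{ml})\in\mathbb{Z}^{L\times L}$ is an integer matrix whose reduction mod $\gamma$ is invertible over $\mathbb{F}_\gamma$. For $\mathcal{S},\mathcal{S}'\subseteq\mathcal{I}_L$, $A(\mathcal{S},\mathcal{S}')$ is the submatrix with rows in $\mathcal{S}$ and columns in $\mathcal{S}'$;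 ranks are computed over $\mathbb{F}_\gamma$ after reduction mod $\gamma$, and a matrix with no rows or no columns has rank $0$. For $m\in\mathcal{I}_L$, $v_m=\big(\sum_{l=1}^L a_{ml}(t_l-Q_{\Lambda_{s,l}}(t_l-\beta_l d_l))\big)\bmod\Lambda_1$ and, for $k\in\mathcal{I}_{2L-1}$, $v_{m,k}=Q_{\Lambda_{k+1}}(v_m)\bmod\Lambda_k$. Index sets: for a permutation $\pi_\alpha$ of $\mathcal{I}_L$, $\Pi_\alpha(\mathcal{S})=\{\pi_\alpha(i):i\in\mathcal{S}\}$, and for $m\in\mathcal{I}_L$, $\mathcal{J}_m=\{k\in\mathcal{I}_{2L-1}:\operatorname{rank}A(\Pi_\alpha(\overline{\mathcal{I}_{m-1}}),\mathcal{L}_k)=\operatorname{rank}A(\Pi_\alpha(\overline{\mathcal{I}_m}),\mathcal{L}_k)+1\}$. If $\mathcal{J}_{\pi_\alpha^{-1}(m)}$ is empty, $\delta_m:=0$.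
   Formalization: The fixed tie-breaking rule of the nearest-point quantizer is assumed compatible with lattice translations, i.e. Q_Λ(x+p)=Q_Λ(x)+p for all p in Λ; for arbitrary tie-breaking the claim can fail at boundary points. *)

theory Defs
  imports "HOL-Analysis.Analysis"
begin

definition lin_indep_mod :: "int \<Rightarrow> ('r \<Rightarrow> 'c \<Rightarrow> int) \<Rightarrow> 'r set \<Rightarrow> 'c set \<Rightarrow> bool" where
  "lin_indep_mod \<gamma> M S U \<longleftrightarrow>
     (\<forall>c :: 'c \<Rightarrow> int. (\<forall>i\<in>S. (\<Sum>j\<in>U. M i j * c j) mod \<gamma> = 0)
        \<longrightarrow> (\<forall>j\<in>U. c j mod \<gamma> = 0))"

text \<open>Rank over F_gamma of the submatrix with rows S and columns T (T finite):
  maximal number of linearly independent columns. Empty row or column set gives 0.\<close>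
definition rank_mod :: "int \<Rightarrow> ('r \<Rightarrow> 'c \<Rightarrow> int) \<Rightarrow> 'r set \<Rightarrow> 'c set \<Rightarrow> nat" where
  "rank_mod \<gamma> M S T = Max {card U | U. U \<subseteq> T \<and> lin_indep_mod \<gamma> M S U}"

definition invertible_mod :: "int \<Rightarrow> nat \<Rightarrow> (nat \<Rightarrow> nat \<Rightarrow> int) \<Rightarrow> bool" where
  "invertible_mod \<gamma> L A \<longleftrightarrow>
     (\<exists>C :: nat \<Rightarrow> nat \<Rightarrow> int. \<forall>i\<in>{1..L}. \<forall>j\<in>{1..L}.
        (\<Sum>k=1..L. A i k * C k j) mod \<gamma> = (if i = j then 1 else 0))"

text \<open>Lambda_k = B (gamma^-1 g({G_k w : w in F_gamma^{i_k}}) + Z^n), where G_k consists of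
  the first i_k columns (columns indexed 1..K) of G and g reduces mod gamma to
  the representatives 0..gamma-1.\<close>
definition conA_lattice :: "int \<Rightarrow> ('n::finite \<Rightarrow> nat \<Rightarrow> int) \<Rightarrow> real^'n^'n \<Rightarrow> nat \<Rightarrow> (real^'n) set" where
  "conA_lattice \<gamma> G B ik =
     {B *v ((\<chi> i. real_of_int ((\<Sum>j=1..ik. G i j * w j) mod \<gamma>) / real_of_int \<gamma>)
            + (\<chi> i. real_of_int (z i))) | w z. True}"

text \<open>Q is a nearest-point quantizer of the lattice Lam with a fixed (lattice-translation
  compatible) tie-breaking rule.\<close>
definition nearest_quantizer :: "(real^'n) set \<Rightarrow> (real^'n \<Rightarrow> real^'n) \<Rightarrow> bool" where
  "nearest_quantizer Lam Q \<longleftrightarrow>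
     (\<forall>x. Q x \<in> Lam \<and> (\<forall>y\<in>Lam. dist x (Q x) \<le> dist x y)) \<and>
     (\<forall>x. \<forall>p\<in>Lam. Q (x + p) = Q x + p)"

definition lmod :: "((real^'n) set \<Rightarrow> real^'n \<Rightarrow> real^'n) \<Rightarrow> (real^'n) set \<Rightarrow> real^'n \<Rightarrow> real^'n" where
  "lmod Q Lam x = x - Q Lam x"

definition voronoi :: "((real^'n) set \<Rightarrow> real^'n \<Rightarrow> real^'n) \<Rightarrow> (real^'n) set \<Rightarrow> (real^'n) set" where
  "voronoi Q Lam = {x. Q Lam x = 0}"

end

theory Submission
  imports Defs
begin

text \<open>Compare two tuples of codewords with the same dithers and the same compressed codewords.
  Descending along the lattice chain, one shows that every \<open>v\<^sub>m\<close> is determined modulo \<open>\<Lambda>\<^sub>k\<close>.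
  Suppose this is known modulo \<open>\<Lambda>\<^sub>k\<^sub>+\<^sub>1\<close>. Since \<open>A\<close> is invertible modulo \<open>\<gamma>\<close> and
  \<open>\<gamma> \<Lambda>\<^sub>2\<^sub>L \<subseteq> \<Lambda>\<^sub>1\<close>, the dithered codewords are determined modulo \<open>\<Lambda>\<^sub>k\<^sub>+\<^sub>1\<close> too, so that only those with
  index in \<open>\<L>\<^sub>k\<close> can still differ modulo \<open>\<Lambda>\<^sub>k\<close>. Now go through the rows of \<open>A\<close> in the order
  opposite to \<open>\<pi>\<^sub>\<alpha>\<close>. If a row increases the rank on the columns \<open>\<L>\<^sub>k\<close>, the layer \<open>v\<^sub>m\<^sub>,\<^sub>k\<close> can be read off
  \<open>\<delta>\<^sub>m\<close>; otherwise the row is on \<open>\<L>\<^sub>k\<close> a combination modulo \<open>\<gamma>\<close> of rows already treated.\<close>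

section \<open>Rank modulo a prime\<close>

text \<open>All sums run over the fixed set \<open>T\<close>, and \<open>U\<close> only bounds the
  support of \<open>c\<close>, so coefficient vectors for different \<open>U\<close> can be combined
  linearly.\<close>

lemma lin_indep_mod_iff:
  fixes M :: "'r \<Rightarrow> 'c \<Rightarrow> int"
  assumes "finite T" "U \<subseteq> T"
  shows "lin_indep_mod \<gamma> M S U \<longleftrightarrow>
    (\<forall>c. (\<forall>j. j \<notin> U \<longrightarrow> c j = 0) \<and> (\<forall>i\<in>S. \<gamma> dvd (\<Sum>j\<in>T. M i j * c j)) \<longrightarrow> (\<forall>j. \<gamma> dvd c j))"
    (is "_ \<longleftrightarrow> ?R")
proof
  assume ind: "lin_indep_mod \<gamma> M S U"
  show ?R
  proof (intro allI impI, elim conjE)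
    fix c :: "'c \<Rightarrow> int" and j
    assume supp: "\<forall>j. j \<notin> U \<longrightarrow> c j = 0" and ker: "\<forall>i\<in>S. \<gamma> dvd (\<Sum>j\<in>T. M i j * c j)"
    have "(\<Sum>j\<in>T. M i j * c j) = (\<Sum>j\<in>U. M i j * c j)" for i
      using assms supp by (intro sum.mono_neutral_right) auto
    with ker ind have "\<forall>j\<in>U. \<gamma> dvd c j"
      unfolding lin_indep_mod_def by (simp add: dvd_eq_mod_eq_0)
    then show "\<gamma> dvd c j"
      using supp by (cases "j \<in> U") auto
  qed
next
  assume R: ?R
  show "lin_indep_mod \<gamma> M S U"
    unfolding lin_indep_mod_def
  proof (intro allI impI)
    fix c :: "'c \<Rightarrow> int"
    assume ker: "\<forall>i\<in>S. (\<Sum>j\<in>U. M i j * c j) mod \<gamma> = 0"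
    define c' where "c' = (\<lambda>j. if j \<in> U then c j else 0)"
    have "(\<Sum>j\<in>T. M i j * c' j) = (\<Sum>j\<in>U. M i j * c j)" for i
      using assms by (intro sum.mono_neutral_cong_right) (auto simp: c'_def)
    with ker have "\<forall>i\<in>S. \<gamma> dvd (\<Sum>j\<in>T. M i j * c' j)"
      by (simp add: dvd_eq_mod_eq_0)
    moreover have "\<forall>j. j \<notin> U \<longrightarrow> c' j = 0"
      by (simp add: c'_def)
    ultimately have "\<forall>j. \<gamma> dvd c' j"
      using R by blast
    then show "\<forall>j\<in>U. c j mod \<gamma> = 0"
      unfolding c'_def by (metis dvd_eq_mod_eq_0)
  qed
qed

text \<open>Integer elimination: \<open>p\<close> and \<open>q\<close> are chosen so that a row or
  an entry of the combination cancels, which avoids dividing modulo \<gamma>.\<close>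

lemma sum_mult_lincomb:
  fixes x c d :: "'a \<Rightarrow> 'b::comm_ring"
  shows "(\<Sum>j\<in>T. x j * (p * c j - q * d j)) = p * (\<Sum>j\<in>T. x j * c j) - q * (\<Sum>j\<in>T. x j * d j)"
  by (simp add: sum_distrib_left sum_subtractf algebra_simps)

text \<open>Induction on the rows. If \<open>r\<close> already vanishes on the kernel of
  \<open>S\<close>, row \<open>s\<close> gets coefficient 0; otherwise subtracting a suitable
  multiple of row \<open>s\<close> makes it vanish there.\<close>

lemma row_combination_mod:
  fixes M :: "'r \<Rightarrow> 'c \<Rightarrow> int"
  assumes "prime \<gamma>" "finite T" "finite S"
    and "\<And>c. \<forall>i\<in>S. \<gamma> dvd (\<Sum>j\<in>T. M i j * c j) \<Longrightarrow> \<gamma> dvd (\<Sum>j\<in>T. r j * c j)"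
  shows "\<exists>a. \<forall>j\<in>T. \<gamma> dvd r j - (\<Sum>i\<in>S. a i * M i j)"
  using assms(3,4)
proof (induction S arbitrary: r rule: finite_induct)
  case empty
  \<comment> \<open>The unit vector at \<open>j\<close> picks out the entry
    \<open>r j\<close>.\<close>
  have "\<gamma> dvd r j" if "j \<in> T" for j
    using empty[of "\<lambda>i. if i = j then 1 else 0"] that \<open>finite T\<close>
    by (simp add: if_distrib[of "\<lambda>x. _ * x"] cong: if_cong)
  then show ?case by simp
next
  case (insert s S)
  show ?case
  proof (cases "\<forall>c. (\<forall>i\<in>S. \<gamma> dvd (\<Sum>j\<in>T. M i j * c j)) \<longrightarrow> \<gamma> dvd (\<Sum>j\<in>T. r j * c j)")
    case True
    then obtain a where a: "\<forall>j\<in>T. \<gamma> dvd r j - (\<Sum>i\<in>S. a i * M i j)"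
      using insert.IH by blast
    have "(\<Sum>i\<in>insert s S. (a(s := 0)) i * M i j) = (\<Sum>i\<in>S. a i * M i j)" for j
      using insert.hyps by (auto intro!: sum.cong)
    then show ?thesis using a by metis
  next
    case False
    then obtain c0 where c0: "\<forall>i\<in>S. \<gamma> dvd (\<Sum>j\<in>T. M i j * c0 j)"
      and r0: "\<not> \<gamma> dvd (\<Sum>j\<in>T. r j * c0 j)" by blast
    define e where "e = (\<Sum>j\<in>T. M s j * c0 j)"
    define f where "f = (\<Sum>j\<in>T. r j * c0 j)"
    have "\<not> \<gamma> dvd e"
      using insert.prems[of c0] c0 r0 by (auto simp: e_def)
    then have "coprime \<gamma> e"
      using \<open>prime \<gamma>\<close> by (simp add: prime_imp_coprime)
    \<comment> \<open>Modulo \<gamma>, \<open>u\<close> inverts \<open>e\<close>, so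
      \<open>r\<close> minus \<open>u * f\<close> times row \<open>s\<close> vanishes at
      \<open>c0\<close>.\<close>
    then obtain u w where uw: "u * e + w * \<gamma> = 1"
      using bezout_int[of e \<gamma>] by (auto simp: coprime_iff_gcd_eq_1 gcd.commute)
    have "\<gamma> dvd (\<Sum>j\<in>T. (r j - u * f * M s j) * c j)"
      if c: "\<forall>i\<in>S. \<gamma> dvd (\<Sum>j\<in>T. M i j * c j)" for c
    proof -
      define g where "g = (\<Sum>j\<in>T. M s j * c j)"
      define h where "h = (\<Sum>j\<in>T. r j * c j)"
      \<comment> \<open>Correcting \<open>c\<close> along \<open>c0\<close> makes row
        \<open>s\<close> vanish as well, so the premise on \<open>r\<close> applies.\<close>
      have "\<forall>i\<in>insert s S. \<gamma> dvd (\<Sum>j\<in>T. M i j * (e * c j - g * c0 j))"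
        unfolding sum_mult_lincomb using c c0 by (auto simp: e_def g_def)
      then have "\<gamma> dvd (\<Sum>j\<in>T. r j * (e * c j - g * c0 j))"
        by (rule insert.prems)
      then have "\<gamma> dvd e * h - g * f"
        unfolding sum_mult_lincomb f_def h_def .
      then have "\<gamma> dvd u * (e * h - g * f) + \<gamma> * (w * h)"
        by simp
      also have "u * (e * h - g * f) + \<gamma> * (w * h) = (u * e + w * \<gamma>) * h - u * f * g"
        by (simp add: algebra_simps)
      also have "\<dots> = (\<Sum>j\<in>T. (r j - u * f * M s j) * c j)"
        unfolding uw g_def h_def by (simp add: algebra_simps sum_subtractf sum_distrib_left)
      finally show ?thesis .
    qed
    then obtain a where a: "\<forall>j\<in>T. \<gamma> dvd (r j - u * f * M s j) - (\<Sum>i\<in>S. a i * M i j)"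
      using insert.IH[of "\<lambda>j. r j - u * f * M s j"] by blast
    have "(\<Sum>i\<in>insert s S. (a(s := u * f)) i * M i j) = u * f * M s j + (\<Sum>i\<in>S. a i * M i j)" for j
      using insert.hyps by (auto intro!: sum.cong)
    then have "\<forall>j\<in>T. \<gamma> dvd r j - (\<Sum>i\<in>insert s S. (a(s := u * f)) i * M i j)"
      using a by (simp add: diff_diff_eq)
    then show ?thesis by blast
  qed
qed

text \<open>If no column could be added, each \<open>j\<close> outside \<open>U\<close> would carry
  a relation killed by \<open>S\<close> and \<open>i0\<close>, with a unit at \<open>j\<close>.
  These relations clear the entries outside \<open>U\<close> of any kernel vector of
  \<open>S\<close>, changing its value on row \<open>i0\<close> by units only. The rest is supported
  on \<open>U\<close>, hence trivial, so row \<open>i0\<close> would vanish at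
  \<open>c0\<close>.\<close>

lemma lin_indep_mod_extend:
  assumes "prime \<gamma>" "finite T" "U \<subseteq> T" and ind: "lin_indep_mod \<gamma> M S U"
    and c0: "\<forall>i\<in>S. \<gamma> dvd (\<Sum>j\<in>T. M i j * c0 j)" "\<not> \<gamma> dvd (\<Sum>j\<in>T. M i0 j * c0 j)"
  shows "\<exists>j\<in>T - U. lin_indep_mod \<gamma> M (insert i0 S) (insert j U)"
proof (rule ccontr)
  assume "\<not> ?thesis"
  then have dep: "\<not> lin_indep_mod \<gamma> M (insert i0 S) (insert j U)" if "j \<in> T - U" for j
    using that by blast
  have U0: "\<gamma> dvd c j" if "\<forall>j. j \<notin> U \<longrightarrow> c j = 0" "\<forall>i\<in>S. \<gamma> dvd (\<Sum>j\<in>T. M i j * c j)" for c j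
    using ind that lin_indep_mod_iff[OF assms(2,3)] by blast
  \<comment> \<open>\<open>W\<close> bounds the support of \<open>c\<close> outside
    \<open>U\<close>; each induction step clears one entry.\<close>
  have "\<gamma> dvd (\<Sum>j\<in>T. M i0 j * c j)"
    if "finite W" "W \<subseteq> T - U" "\<forall>j. j \<notin> U \<union> W \<longrightarrow> c j = 0"
      "\<forall>i\<in>S. \<gamma> dvd (\<Sum>j\<in>T. M i j * c j)" for W c
    using that
  proof (induction W arbitrary: c rule: finite_induct)
    case empty
    then show ?case using U0[of c] by (auto intro!: dvd_sum)
  next
    case (insert j W)
    then have j: "j \<in> T - U" by simp
    have "insert j U \<subseteq> T" using j assms(3) by simp
    obtain \<rho> j' where \<rho>: "\<forall>i. i \<notin> insert j U \<longrightarrow> \<rho> i = 0"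
        "\<forall>i\<in>insert i0 S. \<gamma> dvd (\<Sum>j\<in>T. M i j * \<rho> j)" "\<not> \<gamma> dvd \<rho> j'"
      using dep[OF j] unfolding lin_indep_mod_iff[OF assms(2) \<open>insert j U \<subseteq> T\<close>] by blast
    \<comment> \<open>Otherwise dropping the entry at \<open>j\<close> would leave a nontrivial
      relation inside \<open>U\<close>.\<close>
    have "\<not> \<gamma> dvd \<rho> j"
    proof
      assume "\<gamma> dvd \<rho> j"
      define \<rho>' where "\<rho>' = \<rho>(j := 0)"
      have eq: "(\<Sum>j\<in>T. M i j * \<rho> j) = M i j * \<rho> j + (\<Sum>j\<in>T. M i j * \<rho>' j)" for i
      proof -
        have "(\<Sum>j\<in>T - {j}. M i j * \<rho> j) = (\<Sum>j\<in>T. M i j * \<rho>' j)"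
          using j assms(2) by (intro sum.mono_neutral_cong_left) (auto simp: \<rho>'_def)
        then show ?thesis
          using sum.remove[OF assms(2), of j "\<lambda>j. M i j * \<rho> j"] j by simp
      qed
      have "\<gamma> dvd (\<Sum>j\<in>T. M i j * \<rho>' j)" if "i \<in> S" for i
        using bspec[OF \<rho>(2) insertI2[OF that]] \<open>\<gamma> dvd \<rho> j\<close> unfolding eq
        by (simp add: dvd_add_right_iff)
      then have "\<gamma> dvd \<rho>' j'"
        using \<rho>(1) by (intro U0) (auto simp: \<rho>'_def)
      then show False using \<rho>(3) \<open>\<gamma> dvd \<rho> j\<close> by (auto simp: \<rho>'_def split: if_splits)
    qed
    \<comment> \<open>Entry \<open>j\<close> cancels, while the value on row \<open>i0\<close>,
      which kills \<open>\<rho>\<close>, only gains the factor \<open>\<rho> j\<close> modulo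
      \<gamma>.\<close>
    have "\<gamma> dvd (\<Sum>l\<in>T. M i0 l * (\<rho> j * c l - c j * \<rho> l))"
    proof (rule insert.IH)
      show "\<forall>l. l \<notin> U \<union> W \<longrightarrow> \<rho> j * c l - c j * \<rho> l = 0"
      proof (intro allI impI)
        fix l assume "l \<notin> U \<union> W"
        then show "\<rho> j * c l - c j * \<rho> l = 0"
          using insert.prems(2) \<rho>(1) by (cases "l = j") auto
      qed
      show "\<forall>i\<in>S. \<gamma> dvd (\<Sum>l\<in>T. M i l * (\<rho> j * c l - c j * \<rho> l))"
        unfolding sum_mult_lincomb using insert.prems(3) \<rho>(2) by auto
    qed (use insert.prems in auto)
    then have "\<gamma> dvd \<rho> j * (\<Sum>l\<in>T. M i0 l * c l)"
      unfolding sum_mult_lincomb using \<rho>(2) by (simp add: dvd_diff_left_iff)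
    then show ?case
      using \<open>prime \<gamma>\<close> \<open>\<not> \<gamma> dvd \<rho> j\<close> prime_dvd_mult_iff by blast
  qed
  \<comment> \<open>Cutting \<open>c0\<close> off outside \<open>T\<close> gives the required
    support and leaves the sums over \<open>T\<close> unchanged.\<close>
  from this[of "T - U" "\<lambda>j. if j \<in> T then c0 j else 0"] show False
    using c0 assms(2) by simp
qed

text \<open>On vectors supported in \<open>U\<close>, row \<open>i0\<close> is injective on the
  kernel of \<open>S\<close>, so this kernel is at most a line modulo \<gamma>. Deleting a column
  where a spanning vector is nonzero leaves only trivial relations.\<close>

lemma lin_indep_mod_remove:
  assumes "prime \<gamma>" "finite T" "U \<subseteq> T" and ind: "lin_indep_mod \<gamma> M (insert i0 S) U"
  shows "\<exists>U'\<subseteq>U. lin_indep_mod \<gamma> M S U' \<and> card U \<le> card U' + 1"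
proof (cases "lin_indep_mod \<gamma> M S U")
  case True
  then show ?thesis by auto
next
  case False
  then obtain c j where c: "\<forall>j. j \<notin> U \<longrightarrow> c j = 0" "\<forall>i\<in>S. \<gamma> dvd (\<Sum>j\<in>T. M i j * c j)"
      "\<not> \<gamma> dvd c j"
    using lin_indep_mod_iff[OF assms(2,3)] by blast
  have I: "\<gamma> dvd c j" if "\<forall>j. j \<notin> U \<longrightarrow> c j = 0" "\<forall>i\<in>insert i0 S. \<gamma> dvd (\<Sum>j\<in>T. M i j * c j)" for c j
    using ind that lin_indep_mod_iff[OF assms(2,3)] by blast
  have "j \<in> U" using c by auto
  have "lin_indep_mod \<gamma> M S (U - {j})"
    unfolding lin_indep_mod_iff[OF assms(2) subset_trans[OF Diff_subset assms(3)]]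
  proof (intro allI impI, elim conjE)
    fix c' j'
    assume c': "\<forall>l. l \<notin> U - {j} \<longrightarrow> c' l = 0" "\<forall>i\<in>S. \<gamma> dvd (\<Sum>j\<in>T. M i j * c' j)"
    define f where "f = (\<Sum>l\<in>T. M i0 l * c l)"
    define f' where "f' = (\<Sum>l\<in>T. M i0 l * c' l)"
    \<comment> \<open>The combination is killed by row \<open>i0\<close> too, hence trivial; since
      \<open>c'\<close> is 0 at \<open>j\<close>, only \<open>f' * c j\<close> remains
      there.\<close>
    have "\<gamma> dvd f * c' j - f' * c j"
    proof (rule I)
      show "\<forall>i\<in>insert i0 S. \<gamma> dvd (\<Sum>l\<in>T. M i l * (f * c' l - f' * c l))"
        unfolding sum_mult_lincomb using c c' by (auto simp: f_def f'_def)
    qed (use c c' in auto)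
    then have "\<gamma> dvd f' * c j"
      using c' by simp
    then have "\<gamma> dvd f'"
      using c(3) \<open>prime \<gamma>\<close> prime_dvd_mult_iff by blast
    then show "\<gamma> dvd c' j'"
      using c' by (intro I) (auto simp: f'_def)
  qed
  moreover have "card U = card (U - {j}) + 1"
    using card_Suc_Diff1[OF finite_subset[OF assms(3,2)] \<open>j \<in> U\<close>] by (simp only: Suc_eq_plus1)
  ultimately show ?thesis by (intro exI[of _ "U - {j}"]) auto
qed

lemma rank_mod_le_iff:
  assumes "finite T"
  shows "rank_mod \<gamma> M S T \<le> n \<longleftrightarrow> (\<forall>U\<subseteq>T. lin_indep_mod \<gamma> M S U \<longrightarrow> card U \<le> n)"
proof -
  have eq: "{card U | U. U \<subseteq> T \<and> lin_indep_mod \<gamma> M S U}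
      = card ` {U. U \<subseteq> T \<and> lin_indep_mod \<gamma> M S U}"
    by auto
  have "lin_indep_mod \<gamma> M S {}"
    by (simp add: lin_indep_mod_def)
  then show ?thesis
    unfolding rank_mod_def eq using assms by (subst Max_le_iff) auto
qed

lemma rank_mod_ge_iff:
  assumes "finite T"
  shows "n \<le> rank_mod \<gamma> M S T \<longleftrightarrow> (\<exists>U\<subseteq>T. lin_indep_mod \<gamma> M S U \<and> n \<le> card U)"
proof (cases n)
  case 0
  then show ?thesis by (auto simp: lin_indep_mod_def intro!: exI[of _ "{}"])
next
  case (Suc m)
  then have "n \<le> rank_mod \<gamma> M S T \<longleftrightarrow> \<not> rank_mod \<gamma> M S T \<le> m"
    by auto
  then show ?thesis
    unfolding rank_mod_le_iff[OF assms] using Suc by (auto simp: not_le Suc_le_eq)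
qed

text \<open>Otherwise some kernel vector of \<open>S\<close> is nonzero on row \<open>i0\<close>.
  Then the row gains at least one column by \<open>lin_indep_mod_extend\<close> and at most one by
  \<open>lin_indep_mod_remove\<close>, so the rank grows by exactly 1.\<close>

lemma rank_mod_insert_row:
  assumes "prime \<gamma>" "finite T" "finite S"
    and "rank_mod \<gamma> M (insert i0 S) T \<noteq> rank_mod \<gamma> M S T + 1"
  shows "\<exists>a. \<forall>j\<in>T. \<gamma> dvd M i0 j - (\<Sum>i\<in>S. a i * M i j)"
proof (rule row_combination_mod[OF assms(1-3)], rule ccontr)
  fix c0
  assume c0: "\<forall>i\<in>S. \<gamma> dvd (\<Sum>j\<in>T. M i j * c0 j)" "\<not> \<gamma> dvd (\<Sum>j\<in>T. M i0 j * c0 j)"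
  have "rank_mod \<gamma> M (insert i0 S) T \<le> rank_mod \<gamma> M S T + 1"
    unfolding rank_mod_le_iff[OF assms(2)]
  proof (intro allI impI)
    fix U assume U: "U \<subseteq> T" "lin_indep_mod \<gamma> M (insert i0 S) U"
    obtain U' where U': "U' \<subseteq> U" "lin_indep_mod \<gamma> M S U'" "card U \<le> card U' + 1"
      using lin_indep_mod_remove[OF assms(1,2) U] by blast
    then have "card U' \<le> rank_mod \<gamma> M S T"
      using U(1) by (subst rank_mod_ge_iff[OF assms(2)]) blast
    then show "card U \<le> rank_mod \<gamma> M S T + 1"
      using U'(3) by simp
  qed
  moreover have "rank_mod \<gamma> M S T + 1 \<le> rank_mod \<gamma> M (insert i0 S) T"
  proof -
    obtain U where U: "U \<subseteq> T" "lin_indep_mod \<gamma> M S U" "rank_mod \<gamma> M S T \<le> card U"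
      using rank_mod_ge_iff[OF assms(2), of "rank_mod \<gamma> M S T"] by blast
    then obtain j where "j \<in> T - U" "lin_indep_mod \<gamma> M (insert i0 S) (insert j U)"
      using lin_indep_mod_extend[OF assms(1,2) U(1,2) c0] by blast
    moreover have "card (insert j U) = card U + 1"
      using calculation U(1) assms(2) by (simp add: finite_subset)
    ultimately show ?thesis
      unfolding rank_mod_ge_iff[OF assms(2)] using U by (intro exI[of _ "insert j U"]) auto
  qed
  ultimately show False using assms(4) by simp
qed

text \<open>The definition supplies a right inverse \<open>C\<close>. It makes \<open>A\<close>
  surjective on the finite set of residue vectors, hence injective. Since A(CA - I) = (AC - I)A
  vanishes modulo \<gamma>, the same \<open>C\<close> is a left inverse.\<close>

lemma invertible_mod_left_inverse:
  assumes "\<gamma> > 0" "invertible_mod \<gamma> L A"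
  obtains C where "\<And>i j. i \<in> {1..L} \<Longrightarrow> j \<in> {1..L} \<Longrightarrow>
    \<gamma> dvd (\<Sum>k=1..L. C i k * A k j) - (if i = j then 1 else 0)"
proof -
  obtain C where C: "\<And>i j. i \<in> {1..L} \<Longrightarrow> j \<in> {1..L} \<Longrightarrow>
      (\<Sum>k=1..L. A i k * C k j) mod \<gamma> = (if i = j then 1 else 0)"
    using assms(2) unfolding invertible_mod_def by blast
  \<comment> \<open>\<open>V\<close> is the space of residue vectors and \<open>F\<close> is
    multiplication by \<open>A\<close> on it; restriction to the index range makes equal vectors
    equal functions.\<close>
  define V :: "(nat \<Rightarrow> int) set" where "V = (\<Pi>\<^sub>E i\<in>{1..L}. {0..<\<gamma>})"
  define F where "F = (\<lambda>c. restrict (\<lambda>i. (\<Sum>k=1..L. A i k * c k) mod \<gamma>) {1..L})"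
  have F_mod: "(\<Sum>k=1..L. A i k * restrict (\<lambda>i. c i mod \<gamma>) {1..L} k) mod \<gamma>
      = (\<Sum>k=1..L. A i k * c k) mod \<gamma>" for c :: "nat \<Rightarrow> int" and i
  proof -
    have "(\<Sum>k=1..L. A i k * restrict (\<lambda>i. c i mod \<gamma>) {1..L} k)
        = (\<Sum>k=1..L. A i k * (c k mod \<gamma>))"
      by (intro sum.cong) auto
    also have "\<dots> mod \<gamma> = (\<Sum>k=1..L. (A i k * (c k mod \<gamma>)) mod \<gamma>) mod \<gamma>"
      by (rule mod_sum_eq[symmetric])
    also have "\<dots> = (\<Sum>k=1..L. (A i k * c k) mod \<gamma>) mod \<gamma>"
      by (simp add: mod_mult_right_eq)
    finally show ?thesis by (simp add: mod_sum_eq)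
  qed
  have "V \<subseteq> F ` V"
  proof
    fix b assume b: "b \<in> V"
    \<comment> \<open>Applying \<open>C\<close> to \<open>b\<close> and reducing modulo \<gamma>
      gives a preimage of \<open>b\<close>.\<close>
    define c where "c = (\<lambda>k. \<Sum>j=1..L. C k j * b j)"
    have "F (restrict (\<lambda>i. c i mod \<gamma>) {1..L}) = b"
    proof (rule PiE_ext[of _ "{1..L}" "\<lambda>_. UNIV"])
      show "b \<in> {1..L} \<rightarrow>\<^sub>E UNIV" using b by (auto simp: V_def)
      fix i assume i: "i \<in> {1..L}"
      have "(\<Sum>k=1..L. A i k * c k) = (\<Sum>k=1..L. \<Sum>j=1..L. A i k * C k j * b j)"
        by (simp add: c_def sum_distrib_left mult.assoc)
      also have "\<dots> = (\<Sum>j=1..L. (\<Sum>k=1..L. A i k * C k j) * b j)"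
        by (subst sum.swap) (simp add: sum_distrib_right)
      also have "\<dots> mod \<gamma> = (\<Sum>j=1..L. ((\<Sum>k=1..L. A i k * C k j) mod \<gamma> * b j) mod \<gamma>) mod \<gamma>"
        by (simp add: mod_sum_eq mod_mult_left_eq)
      also have "\<dots> = (\<Sum>j=1..L. (if i = j then b j else 0)) mod \<gamma>"
        using i C by (subst mod_sum_eq, intro arg_cong[where f="\<lambda>x. x mod \<gamma>"] sum.cong) auto
      also have "\<dots> = b i"
        using i b by (auto simp: V_def PiE_def Pi_def)
      finally show "F (restrict (\<lambda>i. c i mod \<gamma>) {1..L}) i = b i"
        unfolding F_def by (subst restrict_apply'[OF i]) (simp only: F_mod)
    qed (simp add: F_def)
    moreover have "restrict (\<lambda>i. c i mod \<gamma>) {1..L} \<in> V"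
      using assms(1) by (auto simp: V_def)
    ultimately show "b \<in> F ` V" by (metis imageI)
  qed
  moreover have "finite V"
    by (auto simp: V_def intro!: finite_PiE)
  ultimately have inj: "inj_on F V"
    by (intro finite_surj_inj)
  have zero: "\<gamma> dvd c i"
    if i: "i \<in> {1..L}" and c: "\<And>i. i \<in> {1..L} \<Longrightarrow> \<gamma> dvd (\<Sum>k=1..L. A i k * c k)" for c i
  proof -
    have "F (restrict (\<lambda>i. c i mod \<gamma>) {1..L}) = F (restrict (\<lambda>i. 0) {1..L})"
      unfolding F_def F_mod using c by (intro restrict_ext) (auto simp: dvd_eq_mod_eq_0)
    then have "restrict (\<lambda>i. c i mod \<gamma>) {1..L} = restrict (\<lambda>i. 0) {1..L}"
      by (rule inj_onD[OF inj]) (use assms(1) in \<open>auto simp: V_def\<close>)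
    from fun_cong[OF this, of i] show ?thesis
      using i by (simp add: dvd_eq_mod_eq_0)
  qed
  show thesis
  proof
    fix i j assume ij: "i \<in> {1..L}" "j \<in> {1..L}"
    show "\<gamma> dvd (\<Sum>k=1..L. C i k * A k j) - (if i = j then 1 else 0)"
    proof (rule zero[OF ij(1)])
      fix m assume m: "m \<in> {1..L}"
      have "(\<Sum>i=1..L. A m i * (\<Sum>k=1..L. C i k * A k j)) = (\<Sum>i=1..L. \<Sum>k=1..L. A m i * C i k * A k j)"
        by (simp add: sum_distrib_left mult.assoc)
      also have "\<dots> = (\<Sum>k=1..L. (\<Sum>i=1..L. A m i * C i k) * A k j)"
        by (subst sum.swap) (simp add: sum_distrib_right)
      finally have 1: "(\<Sum>i=1..L. A m i * (\<Sum>k=1..L. C i k * A k j))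
        = (\<Sum>k=1..L. (\<Sum>i=1..L. A m i * C i k) * A k j)" .
      have 2: "(\<Sum>i=1..L. A m i * (if i = j then 1 else 0)) = (\<Sum>k=1..L. (if m = k then 1 else 0) * A k j)"
        using m ij by (simp add: if_distrib[of "\<lambda>x. x * _"] if_distrib[of "\<lambda>x. _ * x"] cong: if_cong)
      have "(\<Sum>i=1..L. A m i * ((\<Sum>k=1..L. C i k * A k j) - (if i = j then 1 else 0)))
        = (\<Sum>k=1..L. ((\<Sum>i=1..L. A m i * C i k) - (if m = k then 1 else 0)) * A k j)"
        by (simp only: right_diff_distrib left_diff_distrib sum_subtractf 1 2)
      also have "\<gamma> dvd \<dots>"
      proof (intro dvd_sum dvd_mult2)
        fix k assume k: "k \<in> {1..L}"
        show "\<gamma> dvd (\<Sum>i=1..L. A m i * C i k) - (if m = k then 1 else 0)"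
          using dvd_minus_mod[of \<gamma> "\<Sum>i=1..L. A m i * C i k"] unfolding C[OF m k] .
      qed
      finally show "\<gamma> dvd (\<Sum>i=1..L. A m i * ((\<Sum>k=1..L. C i k * A k j) - (if i = j then 1 else 0)))" .
    qed
  qed
qed

section \<open>Construction A lattices\<close>

text \<open>Over the integers a subspace is an additive subgroup, so lattice membership can use the
  closure rules of modules.\<close>

interpretation int_span: module "\<lambda>k :: int. scaleR (real_of_int k) :: real^'n \<Rightarrow> real^'n"
  by unfold_locales (simp_all add: algebra_simps)

text \<open>The integer vector \<open>p\<close> absorbs both the representative chosen by
  \<open>mod\<close> and the shift \<open>z\<close>, turning membership into a linear congruence on
  numerators.\<close>

lemma conA_lattice_iff:
  assumes "\<gamma> > 0"
  shows "x \<in> conA_lattice \<gamma> G B ik \<longleftrightarrow>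
    (\<exists>p w. x = B *v (\<chi> i. real_of_int (p i) / real_of_int \<gamma>) \<and>
      (\<forall>i. \<gamma> dvd p i - (\<Sum>j=1..ik. G i j * w j)))"
proof
  assume "x \<in> conA_lattice \<gamma> G B ik"
  then obtain w z where x: "x = B *v ((\<chi> i. real_of_int ((\<Sum>j=1..ik. G i j * w j) mod \<gamma>) / real_of_int \<gamma>)
            + (\<chi> i. real_of_int (z i)))"
    unfolding conA_lattice_def by blast
  define p where "p i = (\<Sum>j=1..ik. G i j * w j) mod \<gamma> + \<gamma> * z i" for i
  have "x = B *v (\<chi> i. real_of_int (p i) / real_of_int \<gamma>)"
    unfolding x using assms
    by (intro arg_cong[where f="\<lambda>y. B *v y"]) (simp add: vec_eq_iff p_def add_divide_distrib)
  moreover have "\<gamma> dvd p i - (\<Sum>j=1..ik. G i j * w j)" for i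
    by (simp add: p_def mod_eq_dvd_iff[symmetric])
  ultimately show "\<exists>p w. x = B *v (\<chi> i. real_of_int (p i) / real_of_int \<gamma>) \<and>
      (\<forall>i. \<gamma> dvd p i - (\<Sum>j=1..ik. G i j * w j))" by blast
next
  assume "\<exists>p w. x = B *v (\<chi> i. real_of_int (p i) / real_of_int \<gamma>) \<and>
      (\<forall>i. \<gamma> dvd p i - (\<Sum>j=1..ik. G i j * w j))"
  then obtain p w where x: "x = B *v (\<chi> i. real_of_int (p i) / real_of_int \<gamma>)"
    and p: "\<And>i. \<gamma> dvd p i - (\<Sum>j=1..ik. G i j * w j)" by blast
  have "p i = (\<Sum>j=1..ik. G i j * w j) mod \<gamma> + \<gamma> * (p i div \<gamma>)" for i
    using p[of i] by (metis mod_eq_dvd_iff mod_mult_div_eq)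
  then have "real_of_int (p i) = real_of_int ((\<Sum>j=1..ik. G i j * w j) mod \<gamma>)
      + real_of_int \<gamma> * real_of_int (p i div \<gamma>)" for i
    by (metis of_int_add of_int_mult)
  then have "real_of_int (p i) / real_of_int \<gamma>
      = real_of_int ((\<Sum>j=1..ik. G i j * w j) mod \<gamma>) / real_of_int \<gamma> + real_of_int (p i div \<gamma>)" for i
    using assms by (simp add: field_simps)
  then have "x = B *v ((\<chi> i. real_of_int ((\<Sum>j=1..ik. G i j * w j) mod \<gamma>) / real_of_int \<gamma>)
            + (\<chi> i. real_of_int (p i div \<gamma>)))"
    unfolding x by (intro arg_cong[where f="\<lambda>y. B *v y"]) (simp only: vec_eq_iff vector_add_component vec_lambda_beta simp_thms)
  then show "x \<in> conA_lattice \<gamma> G B ik"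
    unfolding conA_lattice_def mem_Collect_eq
    by (intro exI[of _ w] exI[of _ "\<lambda>i. p i div \<gamma>"] conjI TrueI)
qed

lemma conA_lattice_subspace:
  assumes "\<gamma> > 0"
  shows "int_span.subspace (conA_lattice \<gamma> G B ik)"
  unfolding int_span.subspace_def
proof (intro conjI ballI allI)
  show "0 \<in> conA_lattice \<gamma> G B ik"
    unfolding conA_lattice_iff[OF assms]
    by (intro exI[of _ "\<lambda>_. 0"]) (simp flip: zero_vec_def)
next
  fix x y assume xy: "x \<in> conA_lattice \<gamma> G B ik" "y \<in> conA_lattice \<gamma> G B ik"
  from xy(1) obtain p w where
    x: "x = B *v (\<chi> i. real_of_int (p i) / real_of_int \<gamma>)" "\<And>i. \<gamma> dvd p i - (\<Sum>j=1..ik. G i j * w j)"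
    unfolding conA_lattice_iff[OF assms] by metis
  from xy(2) obtain q u where
    y: "y = B *v (\<chi> i. real_of_int (q i) / real_of_int \<gamma>)" "\<And>i. \<gamma> dvd q i - (\<Sum>j=1..ik. G i j * u j)"
    unfolding conA_lattice_iff[OF assms] by metis
  have "x + y = B *v (\<chi> i. real_of_int (p i + q i) / real_of_int \<gamma>)"
    unfolding x y matrix_vector_right_distrib[symmetric]
    by (intro arg_cong[where f="\<lambda>y. B *v y"]) (simp add: vec_eq_iff add_divide_distrib)
  moreover have "\<gamma> dvd (p i + q i) - (\<Sum>j=1..ik. G i j * (w j + u j))" for i
    using dvd_add[OF x(2)[of i] y(2)[of i]] by (simp add: algebra_simps sum.distrib)
  ultimately show "x + y \<in> conA_lattice \<gamma> G B ik"
    unfolding conA_lattice_iff[OF assms]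
    by (intro exI[of _ "\<lambda>i. p i + q i"] exI[of _ "\<lambda>j. w j + u j"]) blast
next
  fix c x assume "x \<in> conA_lattice \<gamma> G B ik"
  then obtain p w where
    x: "x = B *v (\<chi> i. real_of_int (p i) / real_of_int \<gamma>)" "\<And>i. \<gamma> dvd p i - (\<Sum>j=1..ik. G i j * w j)"
    unfolding conA_lattice_iff[OF assms] by metis
  have "real_of_int c *\<^sub>R x = B *v (\<chi> i. real_of_int (c * p i) / real_of_int \<gamma>)"
    unfolding x matrix_vector_mult_scaleR[symmetric]
    by (intro arg_cong[where f="\<lambda>y. B *v y"]) (simp add: vec_eq_iff)
  moreover have "\<gamma> dvd c * p i - (\<Sum>j=1..ik. G i j * (c * w j))" for i
    using dvd_mult[OF x(2)[of i], of c] by (simp add: algebra_simps sum_distrib_left)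
  ultimately show "real_of_int c *\<^sub>R x \<in> conA_lattice \<gamma> G B ik"
    unfolding conA_lattice_iff[OF assms]
    by (intro exI[of _ "\<lambda>i. c * p i"] exI[of _ "\<lambda>j. c * w j"]) blast
qed

lemma conA_lattice_mono:
  assumes "\<gamma> > 0" "ik \<le> ik'"
  shows "conA_lattice \<gamma> G B ik \<subseteq> conA_lattice \<gamma> G B ik'"
proof
  fix x assume "x \<in> conA_lattice \<gamma> G B ik"
  then obtain p w where
    x: "x = B *v (\<chi> i. real_of_int (p i) / real_of_int \<gamma>)" "\<And>i. \<gamma> dvd p i - (\<Sum>j=1..ik. G i j * w j)"
    unfolding conA_lattice_iff[OF assms(1)] by metis
  \<comment> \<open>Padding the message with zeros keeps the codeword.\<close>
  have "(\<Sum>j=1..ik'. G i j * (if j \<le> ik then w j else 0)) = (\<Sum>j=1..ik. G i j * w j)" for i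
    using assms(2) by (intro sum.mono_neutral_cong_right) auto
  then show "x \<in> conA_lattice \<gamma> G B ik'"
    unfolding conA_lattice_iff[OF assms(1)] using x
    by (intro exI[of _ p] exI[of _ "\<lambda>j. if j \<le> ik then w j else 0"]) simp
qed

text \<open>The factor \<gamma> clears the denominator and leads into \<open>B\<close> applied to
  integer vectors, which every lattice contains (message 0). Hence integer coefficients matter only
  modulo \<gamma>.\<close>

lemma conA_lattice_scale_dvd:
  assumes "\<gamma> > 0" "\<gamma> dvd c" "x \<in> conA_lattice \<gamma> G B ik"
  shows "real_of_int c *\<^sub>R x \<in> conA_lattice \<gamma> G B ik'"
proof -
  from assms(2) obtain e where c: "c = \<gamma> * e" ..
  from assms(3) obtain p where x: "x = B *v (\<chi> i. real_of_int (p i) / real_of_int \<gamma>)"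
    unfolding conA_lattice_iff[OF assms(1)] by metis
  have "real_of_int c *\<^sub>R x = B *v (\<chi> i. real_of_int (c * p i) / real_of_int \<gamma>)"
    unfolding x matrix_vector_mult_scaleR[symmetric]
    by (intro arg_cong[where f="\<lambda>y. B *v y"]) (simp add: vec_eq_iff)
  then show ?thesis
    unfolding conA_lattice_iff[OF assms(1)]
    by (intro exI[of _ "\<lambda>i. c * p i"] exI[of _ "\<lambda>_. 0"]) (simp add: c)
qed

section \<open>Quantization along a chain of lattices\<close>

text \<open>Right to left rests on the tie-breaking rule commuting with lattice
  translations.\<close>

lemma lmod_eq_iff:
  assumes "int_span.subspace \<Lambda>" "nearest_quantizer \<Lambda> (Q \<Lambda>)"
  shows "lmod Q \<Lambda> x = lmod Q \<Lambda> y \<longleftrightarrow> x - y \<in> \<Lambda>"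
proof
  assume "lmod Q \<Lambda> x = lmod Q \<Lambda> y"
  then have "x - y = Q \<Lambda> x - Q \<Lambda> y"
    by (simp add: lmod_def algebra_simps)
  then show "x - y \<in> \<Lambda>"
    using assms by (simp add: nearest_quantizer_def int_span.subspace_diff)
next
  assume "x - y \<in> \<Lambda>"
  then have "Q \<Lambda> (y + (x - y)) = Q \<Lambda> y + (x - y)"
    using assms(2) unfolding nearest_quantizer_def by blast
  then show "lmod Q \<Lambda> x = lmod Q \<Lambda> y"
    by (simp add: lmod_def)
qed

lemma subspace_diff_mem_iff:
  assumes "int_span.subspace \<Lambda>" "x - y \<in> \<Lambda>"
  shows "x \<in> \<Lambda> \<longleftrightarrow> y \<in> \<Lambda>"
  using int_span.subspace_add[OF assms(1) assms(2), of y] int_span.subspace_diff[OF assms(1) _ assms(2), of x]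
  by auto

text \<open>Isolates what the layer arguments use: nested subgroups with quantizers, apart from
  Construction A.\<close>

locale lattice_chain =
  fixes Lam :: "nat \<Rightarrow> (real^'n) set" and Q :: "(real^'n) set \<Rightarrow> real^'n \<Rightarrow> real^'n" and N :: nat
  assumes subspace: "k \<in> {1..N} \<Longrightarrow> int_span.subspace (Lam k)"
    and quantizer: "k \<in> {1..N} \<Longrightarrow> nearest_quantizer (Lam k) (Q (Lam k))"
    and mono: "k \<in> {1..N} \<Longrightarrow> k' \<in> {1..N} \<Longrightarrow> k \<le> k' \<Longrightarrow> Lam k \<subseteq> Lam k'"
begin

lemma lmod_eq: "k \<in> {1..N} \<Longrightarrow> lmod Q (Lam k) x = lmod Q (Lam k) y \<longleftrightarrow> x - y \<in> Lam k"
  by (intro lmod_eq_iff subspace quantizer)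

text \<open>The layer with the largest index is the sum of all layers modulo its own lattice, because the
  other layers lie in that lattice; subtract it and repeat.\<close>

lemma layers_determined_by_sum:
  assumes J: "J \<subseteq> {1..<N}"
    and a: "\<And>k. k \<in> J \<Longrightarrow> x k \<in> Lam (k+1)" "\<And>k. k \<in> J \<Longrightarrow> y k \<in> Lam (k+1)"
    and eq: "lmod Q (Lam (Min J)) (\<Sum>k\<in>J. lmod Q (Lam k) (x k))
      = lmod Q (Lam (Min J)) (\<Sum>k\<in>J. lmod Q (Lam k) (y k))"
    and k: "k \<in> J"
  shows "lmod Q (Lam k) (x k) = lmod Q (Lam k) (y k)"
  using k
proof (induction "N - k" arbitrary: k rule: less_induct)
  case (less k)
  define D where "D i = lmod Q (Lam i) (x i) - lmod Q (Lam i) (y i)" for i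
  have fin: "finite J" using J finite_subset by blast
  have kN: "k \<in> {1..N}" "Min J \<in> {1..N}" "Min J \<le> k"
    using less.prems J Min_in[OF fin] Min_le[OF fin less.prems] by fastforce+
  have D0: "D i = 0" if "i \<in> J" "k < i" for i
    using less.hyps[of i] that J by (force simp: D_def)
  \<comment> \<open>Reducing a point of \<open>Lam (i+1)\<close> modulo the smaller
    \<open>Lam i\<close> stays in \<open>Lam (i+1)\<close>, and
    \<open>i + 1 \<le> k\<close>.\<close>
  have Dk: "D i \<in> Lam k" if "i \<in> J" "i < k" for i
  proof -
    have i: "i \<in> {1..N}" "i + 1 \<in> {1..N}" "i + 1 \<le> k" using that J kN by auto
    have "lmod Q (Lam i) z \<in> Lam (i+1)" if "z \<in> Lam (i+1)" for z
      unfolding lmod_def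
      using that quantizer[OF i(1)] mono[OF i(1,2)] subspace[OF i(2)]
      by (intro int_span.subspace_diff) (auto simp: nearest_quantizer_def)
    then have "D i \<in> Lam (i+1)"
      unfolding D_def using a \<open>i \<in> J\<close> by (intro int_span.subspace_diff subspace[OF i(2)]) auto
    then show ?thesis using mono[OF i(2) kN(1) i(3)] by blast
  qed
  have "(\<Sum>i\<in>J. D i) \<in> Lam k"
    using eq mono[OF kN(2,1,3)] unfolding lmod_eq[OF kN(2)] by (auto simp: D_def sum_subtractf)
  moreover have "(\<Sum>i\<in>J. D i) - D k = (\<Sum>i\<in>J - {k}. D i)"
    using less.prems fin by (simp add: sum_diff1)
  moreover have "(\<Sum>i\<in>J - {k}. D i) \<in> Lam k"
  proof (rule int_span.subspace_sum[OF subspace[OF kN(1)]])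
    fix i assume "i \<in> J - {k}"
    then show "D i \<in> Lam k"
      using D0 Dk int_span.subspace_0[OF subspace[OF kN(1)]] by (cases i k rule: linorder_cases) auto
  qed
  ultimately have "D k \<in> Lam k"
    using subspace_diff_mem_iff[OF subspace[OF kN(1)]] by metis
  \<comment> \<open>Undoes the reduction modulo \<open>Lam k\<close> in both layers.\<close>
  moreover have "D k - (x k - y k) = Q (Lam k) (y k) - Q (Lam k) (x k)"
    by (simp add: D_def lmod_def)
  moreover have "Q (Lam k) (y k) - Q (Lam k) (x k) \<in> Lam k"
    using quantizer[OF kN(1)] by (intro int_span.subspace_diff subspace[OF kN(1)]) (auto simp: nearest_quantizer_def)
  ultimately have "x k - y k \<in> Lam k"
    using subspace_diff_mem_iff[OF subspace[OF kN(1)]] by metis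
  then show ?case unfolding lmod_eq[OF kN(1)] .
qed

text \<open>Quantizing points congruent modulo \<open>Lam (k+1)\<close> preserves their difference,
  so the layers see all of \<open>x - y\<close> modulo \<open>Lam k\<close>.\<close>

lemma layer_refines:
  assumes k: "k \<in> {1..<N}" and "x - y \<in> Lam (k+1)"
    and "lmod Q (Lam k) (Q (Lam (k+1)) x) = lmod Q (Lam k) (Q (Lam (k+1)) y)"
  shows "x - y \<in> Lam k"
proof -
  have kN: "k \<in> {1..N}" "k + 1 \<in> {1..N}" using k by auto
  have "Q (Lam (k+1)) (y + (x - y)) = Q (Lam (k+1)) y + (x - y)"
    using quantizer[OF kN(2)] assms(2) unfolding nearest_quantizer_def by blast
  then show ?thesis
    using assms(3) unfolding lmod_eq[OF kN(1)] by simp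
qed

end

text \<open>Being a deterministic function of the compressed codewords and the dithers means that
  equal data force equal results. This is asked for all codewords in the codebooks and all dithers
  in the scaled Voronoi regions.\<close>

theorem theorem1:
  fixes \<gamma> :: int and L K :: nat
    and G :: "'n::finite \<Rightarrow> nat \<Rightarrow> int" and B :: "real^'n^'n"
    and ik :: "nat \<Rightarrow> nat"
    and Q :: "(real^'n) set \<Rightarrow> real^'n \<Rightarrow> real^'n"
    and \<pi> \<pi>\<alpha> :: "nat \<Rightarrow> nat"
    and \<beta> :: "nat \<Rightarrow> real"
    and A :: "nat \<Rightarrow> nat \<Rightarrow> int"
  defines "Lam \<equiv> \<lambda>k. conA_lattice \<gamma> G B (ik k)"
  defines "Ls \<equiv> \<lambda>l. Lam (\<pi> (2*l - 1))"
  defines "Lc \<equiv> \<lambda>l. Lam (\<pi> (2*l))"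
  defines "Lset \<equiv> \<lambda>k. {l\<in>{1..L}. Ls l \<subseteq> Lam k \<and> Lam k \<subseteq> Lam (k+1) \<and> Lam (k+1) \<subseteq> Lc l}"
  defines "Jset \<equiv> \<lambda>m. {k\<in>{1..2*L-1}.
             rank_mod \<gamma> A (\<pi>\<alpha> ` ({1..L} - {1..m-1})) (Lset k)
           = rank_mod \<gamma> A (\<pi>\<alpha> ` ({1..L} - {1..m})) (Lset k) + 1}"
  defines "v \<equiv> \<lambda>(t :: nat \<Rightarrow> real^'n) (d :: nat \<Rightarrow> real^'n) m.
             lmod Q (Lam 1) (\<Sum>l=1..L. of_int (A m l) *\<^sub>R (t l - Q (Ls l) (t l - \<beta> l *\<^sub>R d l)))"
  defines "vk \<equiv> \<lambda>t d m k. lmod Q (Lam k) (Q (Lam (k+1)) (v t d m))"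
  defines "\<delta> \<equiv> \<lambda>t d m. (let J = Jset (inv \<pi>\<alpha> m) in
             if J = {} then 0 else lmod Q (Lam (Min J)) (\<Sum>k\<in>J. vk t d m k))"
  assumes "prime \<gamma>" and "L > 0" and "K > 0"
    and "\<forall>i j. 0 \<le> G i j \<and> G i j < \<gamma>"
    and "rank_mod \<gamma> G UNIV {1..K} = K"
    and "invertible B"
    and "\<forall>k\<in>{1..2*L}. \<forall>k'\<in>{1..2*L}. k \<le> k' \<longrightarrow> ik k \<le> ik k'"
    and "ik (2*L) \<le> K"
    and "\<forall>k\<in>{1..2*L}. nearest_quantizer (Lam k) (Q (Lam k))"
    and "\<pi> permutes {1..2*L}"
    and "\<forall>l\<in>{1..L}. Lam (\<pi> (2*l - 1)) \<subseteq> Lam (\<pi> (2*l))"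
    and "\<forall>l\<in>{1..L}. \<beta> l > 0"
    and "invertible_mod \<gamma> L A"
    and "\<pi>\<alpha> permutes {1..L}"
  shows "\<forall>t t' d.
           (\<forall>l\<in>{1..L}. t l \<in> Lc l \<inter> voronoi Q (Ls l) \<and> t' l \<in> Lc l \<inter> voronoi Q (Ls l)
              \<and> d l \<in> (\<lambda>x. (1 / \<beta> l) *\<^sub>R x) ` voronoi Q (Ls l))
           \<and> (\<forall>m\<in>{1..L}. \<delta> t d m = \<delta> t' d m)
           \<longrightarrow> (\<forall>m\<in>{1..L}. v t d m = v t' d m)"
proof (intro allI impI, elim conjE)
  fix t t' d :: "nat \<Rightarrow> real^'n"
  assume td: "\<forall>l\<in>{1..L}. t l \<in> Lc l \<inter> voronoi Q (Ls l) \<and> t' l \<in> Lc l \<inter> voronoi Q (Ls l)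
      \<and> d l \<in> (\<lambda>x. (1 / \<beta> l) *\<^sub>R x) ` voronoi Q (Ls l)"
    and eq\<delta>: "\<forall>m\<in>{1..L}. \<delta> t d m = \<delta> t' d m"

  \<comment> \<open>The lattice chain and the differences to be studied\<close>
  note perm = \<open>\<pi> permutes {1..2*L}\<close> and perm\<alpha> = \<open>\<pi>\<alpha> permutes {1..L}\<close>
  have \<gamma>: "\<gamma> > 0" using \<open>prime \<gamma>\<close> by (rule prime_gt_0_int)
  have sub: "int_span.subspace (Lam k)" for k
    unfolding Lam_def by (rule conA_lattice_subspace[OF \<gamma>])
  have ik: "ik k \<le> ik k'" if "k \<in> {1..2*L}" "k' \<in> {1..2*L}" "k \<le> k'" for k k'
    using \<open>\<forall>k\<in>{1..2*L}. \<forall>k'\<in>{1..2*L}. k \<le> k' \<longrightarrow> ik k \<le> ik k'\<close> that by blast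
  interpret lattice_chain Lam Q "2*L"
  proof
    show "nearest_quantizer (Lam k) (Q (Lam k))" if "k \<in> {1..2*L}" for k
      using \<open>\<forall>k\<in>{1..2*L}. nearest_quantizer (Lam k) (Q (Lam k))\<close> that by blast
    show "Lam k \<subseteq> Lam k'" if "k \<in> {1..2*L}" "k' \<in> {1..2*L}" "k \<le> k'" for k k'
      unfolding Lam_def by (intro conA_lattice_mono \<gamma> ik that)
  qed (rule sub)
  have Lam_dvd: "real_of_int c *\<^sub>R x \<in> Lam k'" if "\<gamma> dvd c" "x \<in> Lam k" for c x k k'
    using that unfolding Lam_def by (rule conA_lattice_scale_dvd[OF \<gamma>])

  \<comment> \<open>Unlike the difference of the \<open>v\<close>, which are reduced modulo
    \<open>Lam 1\<close>, \<open>w\<close> is linear in \<open>y\<close>.\<close>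
  define x where "x = (\<lambda>t l. t l - Q (Ls l) (t l - \<beta> l *\<^sub>R d l))"
  define y where "y = (\<lambda>l. x t l - x t' l)"
  define w where "w = (\<lambda>m. \<Sum>l=1..L. real_of_int (A m l) *\<^sub>R y l)"
  have v_eq: "v s d m = lmod Q (Lam 1) (\<Sum>l=1..L. real_of_int (A m l) *\<^sub>R x s l)" for s m
    by (simp add: v_def x_def)
  have w_eq: "w m = (\<Sum>l=1..L. real_of_int (A m l) *\<^sub>R x t l) - (\<Sum>l=1..L. real_of_int (A m l) *\<^sub>R x t' l)" for m
    by (simp add: w_def y_def scaleR_diff_right sum_subtractf)
  have one: "1 \<in> {1..2*L}" using \<open>L > 0\<close> by simp
  \<comment> \<open>Reduction modulo \<open>Lam 1\<close> is invisible modulo \<open>Lam k\<close>,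
    which contains \<open>Lam 1\<close>.\<close>
  have vw: "v t d m - v t' d m \<in> Lam k \<longleftrightarrow> w m \<in> Lam k" if "k \<in> {1..2*L}" for k m
  proof (rule subspace_diff_mem_iff[OF sub])
    have "v t d m - v t' d m - w m =
        Q (Lam 1) (\<Sum>l=1..L. real_of_int (A m l) *\<^sub>R x t' l) - Q (Lam 1) (\<Sum>l=1..L. real_of_int (A m l) *\<^sub>R x t l)"
      unfolding v_eq w_eq lmod_def by (simp add: algebra_simps)
    also have "\<dots> \<in> Lam 1"
      using quantizer[OF one] by (intro int_span.subspace_diff sub) (auto simp: nearest_quantizer_def)
    finally show "v t d m - v t' d m - w m \<in> Lam k"
      using mono[OF one that] that by auto
  qed

  \<comment> \<open>Differences of dithered codewords in shaping and coding lattices\<close>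
  have idx: "\<pi> (2*l - 1) \<in> {1..2*L}" "\<pi> (2*l) \<in> {1..2*L}" if "l \<in> {1..L}" for l
    unfolding permutes_in_image[OF perm] using that by auto
  have sc: "Ls l \<subseteq> Lc l" if "l \<in> {1..L}" for l
    using \<open>\<forall>l\<in>{1..L}. Lam (\<pi> (2*l - 1)) \<subseteq> Lam (\<pi> (2*l))\<close> that by (simp add: Ls_def Lc_def)
  have qs: "nearest_quantizer (Ls l) (Q (Ls l))" if "l \<in> {1..L}" for l
    unfolding Ls_def by (rule quantizer[OF idx(1)[OF that]])
  have x_mem: "x s l \<in> Lc l" if "l \<in> {1..L}" "s l \<in> Lc l" for s l
    unfolding x_def using that qs[OF that(1)] sc[OF that(1)] sub
    by (intro int_span.subspace_diff) (auto simp: nearest_quantizer_def Lc_def)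
  have y_mem: "y l \<in> Lc l" if "l \<in> {1..L}" for l
    unfolding y_def using td that sub
    by (intro int_span.subspace_diff x_mem) (auto simp: Lc_def)
  \<comment> \<open>The Voronoi region of the shaping lattice holds one point per coset, so
    \<open>t l\<close> and \<open>t' l\<close> coincide; with the same dither, so do the dithered
    codewords.\<close>
  have y_zero: "y l = 0" if l: "l \<in> {1..L}" and y: "y l \<in> Ls l" for l
  proof -
    have "t l - t' l - y l = Q (Ls l) (t l - \<beta> l *\<^sub>R d l) - Q (Ls l) (t' l - \<beta> l *\<^sub>R d l)"
      by (simp add: y_def x_def)
    also have "\<dots> \<in> Ls l"
      using qs[OF l] sub unfolding Ls_def
      by (intro int_span.subspace_diff) (auto simp: nearest_quantizer_def)
    finally have "t l - t' l \<in> Ls l"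
      using y sub subspace_diff_mem_iff unfolding Ls_def by blast
    then have "lmod Q (Ls l) (t l) = lmod Q (Ls l) (t' l)"
      using lmod_eq[OF idx(1)[OF l]] unfolding Ls_def by blast
    then have "t l = t' l"
      using td l by (simp add: lmod_def voronoi_def)
    then show "y l = 0" by (simp add: y_def x_def)
  qed
  obtain C where C: "\<And>i j. i \<in> {1..L} \<Longrightarrow> j \<in> {1..L} \<Longrightarrow>
    \<gamma> dvd (\<Sum>k=1..L. C i k * A k j) - (if i = j then 1 else 0)"
    using invertible_mod_left_inverse[OF \<gamma> \<open>invertible_mod \<gamma> L A\<close>] by blast
  \<comment> \<open>Applying \<open>C\<close> to \<open>w\<close> gives \<open>y\<close> up to
    coefficients divisible by \<gamma>, and \<open>Lam_dvd\<close> absorbs those terms into any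
    lattice.\<close>
  have y_of_w: "y l \<in> Lam k" if w: "\<forall>m\<in>{1..L}. w m \<in> Lam k" and l: "l \<in> {1..L}" for k l
  proof -
    have "(\<Sum>m=1..L. real_of_int (C l m) *\<^sub>R w m)
        = (\<Sum>j=1..L. real_of_int (\<Sum>m=1..L. C l m * A m j) *\<^sub>R y j)"
      unfolding w_def scaleR_sum_right
      by (subst sum.swap) (simp add: scaleR_sum_left)
    moreover have "y l = (\<Sum>j=1..L. real_of_int (if l = j then 1 else 0) *\<^sub>R y j)"
      using l by (simp add: if_distrib[of real_of_int] if_distrib[of "\<lambda>x. x *\<^sub>R _"] cong: if_cong)
    ultimately have "(\<Sum>m=1..L. real_of_int (C l m) *\<^sub>R w m) - y l
        = (\<Sum>j=1..L. real_of_int ((\<Sum>m=1..L. C l m * A m j) - (if l = j then 1 else 0)) *\<^sub>R y j)"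
      by (simp only: of_int_diff scaleR_diff_left sum_subtractf)
    also have "\<dots> \<in> Lam k"
      using C[OF l] y_mem unfolding Lc_def by (intro int_span.subspace_sum sub Lam_dvd) auto
    finally have "(\<Sum>m=1..L. real_of_int (C l m) *\<^sub>R w m) - y l \<in> Lam k" .
    moreover have "(\<Sum>m=1..L. real_of_int (C l m) *\<^sub>R w m) \<in> Lam k"
      using w by (intro int_span.subspace_sum int_span.subspace_scale sub) blast
    ultimately show ?thesis
      using subspace_diff_mem_iff[OF sub] by blast
  qed

  \<comment> \<open>Reading the layers off the compressed codewords\<close>
  have layer: "vk t d m k = vk t' d m k" if m: "m \<in> {1..L}" and k: "k \<in> Jset (inv \<pi>\<alpha> m)" for m k
  proof -
    have J: "Jset (inv \<pi>\<alpha> m) \<subseteq> {1..<2*L}"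
      by (auto simp: Jset_def)
    have Qmem: "Q (Lam (i+1)) z \<in> Lam (i+1)" if "i \<in> Jset (inv \<pi>\<alpha> m)" for i z
      using quantizer[of "i+1"] that J by (force simp: nearest_quantizer_def)
    have "\<delta> t d m = \<delta> t' d m" using eq\<delta> m by blast
    \<comment> \<open>As \<open>k\<close> lies in the index set, the default value 0 for an empty
      set does not occur.\<close>
    then have "lmod Q (Lam (Min (Jset (inv \<pi>\<alpha> m)))) (\<Sum>k\<in>Jset (inv \<pi>\<alpha> m). vk t d m k)
       = lmod Q (Lam (Min (Jset (inv \<pi>\<alpha> m)))) (\<Sum>k\<in>Jset (inv \<pi>\<alpha> m). vk t' d m k)"
      using k by (auto simp: \<delta>_def Let_def split: if_splits)
    then show ?thesis
      unfolding vk_def by (intro layers_determined_by_sum[OF J Qmem Qmem _ k])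
  qed

  \<comment> \<open>One step down the chain\<close>
  have descend: "\<forall>m\<in>{1..L}. w m \<in> Lam k"
    if k: "1 \<le> k" "k < 2*L" and IH: "\<forall>m\<in>{1..L}. w m \<in> Lam (Suc k)" for k
  proof -
    have kL: "k \<in> {1..2*L}" "Suc k \<in> {1..2*L}" using k by auto
    have y_out: "y l \<in> Lam k" if l: "l \<in> {1..L}" "l \<notin> Lset k" for l
    proof -
      \<comment> \<open>Either the shaping index exceeds \<open>k\<close>, so the shaping lattice
        contains \<open>Lam (Suc k)\<close> and \<open>y l\<close> is 0, or the coding index is at
        most \<open>k\<close> and the whole coding lattice lies in \<open>Lam k\<close>.\<close>
      consider "\<not> Ls l \<subseteq> Lam k" | "\<not> Lam (Suc k) \<subseteq> Lc l"
        using l mono[OF kL] unfolding Lset_def by auto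
      then show ?thesis
      proof cases
        case 1
        then have "k < \<pi> (2*l - 1)"
          using mono[OF idx(1)[OF l(1)] kL(1)] unfolding Ls_def by (meson not_le)
        then have "Lam (Suc k) \<subseteq> Ls l"
          unfolding Ls_def by (intro mono kL idx l) simp
        then have "y l = 0"
          using y_of_w[OF IH l(1)] by (intro y_zero l) auto
        then show ?thesis
          using int_span.subspace_0[OF sub] by simp
      next
        case 2
        then have "\<pi> (2*l) < Suc k"
          using mono[OF kL(2) idx(2)[OF l(1)]] unfolding Lc_def by (meson not_le)
        then have "Lc l \<subseteq> Lam k"
          unfolding Lc_def by (intro mono kL idx l) simp
        then show ?thesis using y_mem[OF l(1)] by blast
      qed
    qed
    \<comment> \<open>Larger \<open>j\<close> come first, since the rank condition in
      \<open>Jset j\<close> compares row \<open>\<pi>\<alpha> j\<close> with the rows at later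
      positions.\<close>
    have "w (\<pi>\<alpha> j) \<in> Lam k" if "j \<in> {1..L}" for j
      using that
    proof (induction "L - j" arbitrary: j rule: less_induct)
      case (less j)
      have m: "\<pi>\<alpha> j \<in> {1..L}"
        using less.prems permutes_in_image[OF perm\<alpha>] by blast
      show ?case
      proof (cases "k \<in> Jset j")
        case True
        then have "vk t d (\<pi>\<alpha> j) k = vk t' d (\<pi>\<alpha> j) k"
          using m by (intro layer) (simp_all add: permutes_inverses[OF perm\<alpha>])
        moreover have "v t d (\<pi>\<alpha> j) - v t' d (\<pi>\<alpha> j) \<in> Lam (k+1)"
          using vw[OF kL(2)] IH m by simp
        ultimately have "v t d (\<pi>\<alpha> j) - v t' d (\<pi>\<alpha> j) \<in> Lam k"
          using k unfolding vk_def by (intro layer_refines[of k]) simp_all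
        then show ?thesis
          unfolding vw[OF kL(1)] .
      next
        case False
        define S where "S = \<pi>\<alpha> ` ({1..L} - {1..j})"
        \<comment> \<open>The row sets for \<open>j - 1\<close> and \<open>j\<close> differ exactly
          by row \<open>\<pi>\<alpha> j\<close>, so outside \<open>Jset j\<close> this row does not
          raise the rank.\<close>
        have "{1..L} - {1..j-1} = insert j ({1..L} - {1..j})"
          using less.prems by auto
        then have rank: "rank_mod \<gamma> A (insert (\<pi>\<alpha> j) S) (Lset k) \<noteq> rank_mod \<gamma> A S (Lset k) + 1"
          using False k unfolding Jset_def S_def by auto
        have fin: "finite (Lset k)" "finite S"
          by (simp_all add: Lset_def S_def)
        obtain a where a: "\<forall>l\<in>Lset k. \<gamma> dvd A (\<pi>\<alpha> j) l - (\<Sum>i\<in>S. a i * A i l)"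
          using rank_mod_insert_row[OF \<open>prime \<gamma>\<close> fin rank] by blast
        have "(\<Sum>i\<in>S. real_of_int (a i) *\<^sub>R w i)
            = (\<Sum>l=1..L. real_of_int (\<Sum>i\<in>S. a i * A i l) *\<^sub>R y l)"
          unfolding w_def scaleR_sum_right
          by (subst sum.swap) (simp add: scaleR_sum_left)
        then have "w (\<pi>\<alpha> j) - (\<Sum>i\<in>S. real_of_int (a i) *\<^sub>R w i)
            = (\<Sum>l=1..L. real_of_int (A (\<pi>\<alpha> j) l - (\<Sum>i\<in>S. a i * A i l)) *\<^sub>R y l)"
          unfolding w_def by (simp only: of_int_diff scaleR_diff_left sum_subtractf)
        \<comment> \<open>On columns in \<open>Lset k\<close> the coefficient is divisible by
          \<gamma>; on the others \<open>y l\<close> itself lies in \<open>Lam k\<close>.\<close>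
        also have "\<dots> \<in> Lam k"
        proof (rule int_span.subspace_sum[OF sub])
          fix l assume l: "l \<in> {1..L}"
          show "real_of_int (A (\<pi>\<alpha> j) l - (\<Sum>i\<in>S. a i * A i l)) *\<^sub>R y l \<in> Lam k"
          proof (cases "l \<in> Lset k")
            case True
            then show ?thesis
              using a y_mem[OF l] unfolding Lc_def by (intro Lam_dvd) auto
          next
            case False
            then show ?thesis
              by (intro int_span.subspace_scale sub y_out l)
          qed
        qed
        finally have "w (\<pi>\<alpha> j) - (\<Sum>i\<in>S. real_of_int (a i) *\<^sub>R w i) \<in> Lam k" .
        moreover have "(\<Sum>i\<in>S. real_of_int (a i) *\<^sub>R w i) \<in> Lam k"
        proof (intro int_span.subspace_sum int_span.subspace_scale sub)
          fix i assume "i \<in> S"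
          then show "w i \<in> Lam k"
            using less.hyps less.prems unfolding S_def by auto
        qed
        ultimately show ?thesis
          using subspace_diff_mem_iff[OF sub] by blast
      qed
    qed
    then have "\<forall>m\<in>\<pi>\<alpha> ` {1..L}. w m \<in> Lam k"
      by blast
    then show ?thesis
      unfolding permutes_image[OF perm\<alpha>] .
  qed

  \<comment> \<open>Descent from the finest lattice\<close>
  have "\<forall>m\<in>{1..L}. w m \<in> Lam k" if "k \<le> 2*L" "1 \<le> k" for k
    using that
  proof (induction rule: inc_induct)
    \<comment> \<open>Every coding lattice lies in \<open>Lam (2*L)\<close>, so the start needs no
      information from the compressed codewords.\<close>
    case base
    show ?case
    proof
      fix m
      have "y l \<in> Lam (2*L)" if "l \<in> {1..L}" for l
        using y_mem[OF that] mono[OF idx(2)[OF that], of "2*L"] idx(2)[OF that] \<open>L > 0\<close>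
        unfolding Lc_def by auto
      then show "w m \<in> Lam (2*L)"
        unfolding w_def by (intro int_span.subspace_sum int_span.subspace_scale sub)
    qed
  next
    case (step i)
    have "\<forall>m\<in>{1..L}. w m \<in> Lam (Suc i)"
      using step.prems by (intro step.IH) simp
    then show ?case
      by (rule descend[OF step.prems step.hyps(2)])
  qed
  \<comment> \<open>The \<open>v\<close> are residues modulo \<open>Lam 1\<close>, so congruence
    there is equality.\<close>
  from this[of 1] have "\<forall>m\<in>{1..L}. w m \<in> Lam 1"
    using one by simp
  then show "\<forall>m\<in>{1..L}. v t d m = v t' d m"
    unfolding v_eq lmod_eq[OF one] w_eq .
qed

end
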